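(* Let $N$ be such that the measure $\mathbb P_N$, the open set $\mathcal M$ and the analytic functions $\Phi_N^\pm$ on $\mathcal M$ are as in the context; in particular, with $\sigma_N(z)=z+u_Nz^{-1}$, $$\frac{w(\sigma_N(z);N)}{w(\sigma_N(q_Nz);N)}=\frac{q_N(z^2-u_N)\,\Phi_N^+(z)}{(q_N^2z^2-u_N)\,\Phi_N^-(z)}$$ for $z\in\mathcal M$ with $\sigma_N(z),\sigma_N(q_Nz)$ in the interval on which $w(\cdot;N)$ is defined, and $$\Phi_N^+(q_N^{-M_N-1})=\Phi_N^-(1)=\Phi_N^+(u_Nq_N^{-1})=\Phi_N^-(u_Nq_N^{M_N})=0 .$$ Define $$R_N(z)=\Phi_N^-(z)\,\mathbb E_{\mathbb P_N}\left[\prod_{i=1}^N\frac{\sigma_N(q_Nz)-\ell_i}{\sigma_N(z)-\ell_i}\right]+\Phi_N^+(z)\,\mathbb E_{\mathbb P_N}\left[\prod_{i=1}^N\frac{\sigma_N(z)-\ell_i}{\sigma_N(q_Nz)-\ell_i}\right].$$ Then $R_N(z)$ is analytic in $\mathcal M$. If $\Phi_N^\pm(z)$ are polynomials of degree at most $d$, then so is $R_N(z)$.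
   Context: Parameters: $q_N\in(0,1)$, $M_N\in\mathbb N$ with $M_N\ge N-1$, $u_N\in[0,1)$. Let $\lambda_1<\dots<\lambda_N$ range over integers with $0\le\lambda_1<\dots<\lambda_N\le M_N$ and $\ell_i=q_N^{-\lambda_i}+u_Nq_N^{\lambda_i}$. The probability measure $\mathbb P_N$ on such $N$-tuples is $\mathbb P_N(\ell_1,\dots,\ell_N)\propto\prod_{i<j}(\ell_i-\ell_j)^2\prod_{i=1}^Nw(\ell_i;N)$, where $w(\cdot;N)=\exp(-NV_N(\cdot))$ with $V_N$ real and continuous on $[1+u_N,\ q_N^{-M_N}+u_Nq_N^{M_N}]$. The parameters belong to sequences converging to limits: $\max(N^2|q_N-\mathsf q^{1/N}|,|M_N-N\mathsf M|,N|u_N-\mathsf u|)\le A_1$ for fixed $\mathsf q\in(0,1)$, $\mathsf M\ge1$, $\mathsf u\in[0,1)$, $A_1>0$. The set $\mathcal M\subset\mathbb C\setminus\{0,\pm\sqrt{\mathsf u}\}$ is open and (for the large $N$ under consideration) contains $[q_N,\ q_N^{-M_N-1}]\cup[u_Nq_N^{M_N+1},\ u_Nq_N^{-1}]$. "Analytic in $\mathcal M$" and "polynomial" mean that $R_N$, a priori defined away from finitely many points, extends to such a function. *)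

theory Defs
  imports "HOL-Probability.Probability" "HOL-Computational_Algebra.Polynomial"
begin

definition sigma :: "real \<Rightarrow> complex \<Rightarrow> complex" where
  "sigma u z = z + complex_of_real u * inverse z"

definition lattice_pt :: "real \<Rightarrow> real \<Rightarrow> nat \<Rightarrow> real" where
  "lattice_pt q u x = q powi (- int x) + u * q ^ x"

definition support_interval :: "real \<Rightarrow> real \<Rightarrow> nat \<Rightarrow> real set" where
  "support_interval q u m = {1 + u .. q powi (- int m) + u * q ^ m}"

definition weight :: "nat \<Rightarrow> (real \<Rightarrow> real) \<Rightarrow> real \<Rightarrow> real" where
  "weight N V y = exp (- real N * V y)"

text \<open>A configuration \<open>0 \<le> \<mu>\<^sub>1 < \<dots> < \<mu>\<^sub>N \<le> m\<close> is a function on the index set \<open>{1..N}\<close>;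
  the particle positions are \<open>lattice_pt q u (\<mu> i)\<close>.\<close>

definition configs :: "nat \<Rightarrow> nat \<Rightarrow> (nat \<Rightarrow> nat) set" where
  "configs N m = {\<mu> \<in> {1..N} \<rightarrow>\<^sub>E {0..m}. strict_mono_on {1..N} \<mu>}"

definition gas_weight ::
    "nat \<Rightarrow> real \<Rightarrow> real \<Rightarrow> (real \<Rightarrow> real) \<Rightarrow> (nat \<Rightarrow> nat) \<Rightarrow> real" where
  "gas_weight N q u V \<mu> =
     (\<Prod>(i, j) \<in> {(i, j). 1 \<le> i \<and> i < j \<and> j \<le> N}.
        (lattice_pt q u (\<mu> i) - lattice_pt q u (\<mu> j)) ^ 2) *
     (\<Prod>i = 1..N. weight N V (lattice_pt q u (\<mu> i)))"

definition log_gas ::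
    "nat \<Rightarrow> real \<Rightarrow> real \<Rightarrow> nat \<Rightarrow> (real \<Rightarrow> real) \<Rightarrow> (nat \<Rightarrow> nat) measure" where
  "log_gas N q u m V = point_measure (configs N m)
     (\<lambda>\<mu>. ennreal (gas_weight N q u V \<mu> / (\<Sum>\<nu>\<in>configs N m. gas_weight N q u V \<nu>)))"

definition nekrasov_R ::
    "nat \<Rightarrow> real \<Rightarrow> real \<Rightarrow> nat \<Rightarrow> (real \<Rightarrow> real) \<Rightarrow> (complex \<Rightarrow> complex) \<Rightarrow> (complex \<Rightarrow> complex) \<Rightarrow>
     complex \<Rightarrow> complex" where
  "nekrasov_R N q u m V \<Phi>p \<Phi>m z =
     \<Phi>m z * (LINT \<mu>|log_gas N q u m V. (\<Prod>i = 1..N.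
        (sigma u (q * z) - complex_of_real (lattice_pt q u (\<mu> i))) /
        (sigma u z - complex_of_real (lattice_pt q u (\<mu> i))))) +
     \<Phi>p z * (LINT \<mu>|log_gas N q u m V. (\<Prod>i = 1..N.
        (sigma u z - complex_of_real (lattice_pt q u (\<mu> i))) /
        (sigma u (q * z) - complex_of_real (lattice_pt q u (\<mu> i)))))"

text \<open>The points where a denominator in \<open>nekrasov_R\<close> vanishes for some configuration. There the
  value of \<open>nekrasov_R\<close> is an artefact of \<open>x / 0 = 0\<close>; away from them it is the
  intended function.\<close>

definition exceptional_pts :: "real \<Rightarrow> real \<Rightarrow> nat \<Rightarrow> complex set" where
  "exceptional_pts q u m =
     {z. \<exists>x \<le> m. sigma u z = complex_of_real (lattice_pt q u x) \<or>
                  sigma u (q * z) = complex_of_real (lattice_pt q u x)}"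

lemma finite_exceptional_pts:
  assumes "0 < q"
  shows "finite (exceptional_pts q u m)"
proof -
  have sigma: "finite {z. sigma u z = c}" for c
  proof (rule finite_subset)
    show "{z. sigma u z = c} \<subseteq> insert 0 {z. poly [:complex_of_real u, - c, 1:] z = 0}"
      by (auto simp: sigma_def field_simps)
    show "finite (insert 0 {z. poly [:complex_of_real u, - c, 1:] z = 0})"
      using poly_roots_finite[of "[:complex_of_real u, - c, 1:]"] by simp
  qed
  have "finite {z :: complex. sigma u (q * z) = c}" for c
    using finite_vimageI[OF sigma, of "\<lambda>z. complex_of_real q * z" c] assms
    by (simp add: vimage_def inj_on_def)
  then have "finite (\<Union>x\<le>m. {z :: complex. sigma u z = complex_of_real (lattice_pt q u x)} \<union>
      {z :: complex. sigma u (q * z) = complex_of_real (lattice_pt q u x)})"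
    using sigma by blast
  then show ?thesis
    by (rule rev_finite_subset) (auto simp: exceptional_pts_def)
qed

lemma finite_configs: "finite (configs N m)"
  unfolding configs_def by (rule finite_subset[of _ "{1..N} \<rightarrow>\<^sub>E {0..m}"]) (auto intro: finite_PiE)

lemma configs_nonempty:
  assumes "N \<le> m + 1"
  shows "configs N m \<noteq> {}"
proof -
  have "(\<lambda>i\<in>{1..N}. i - 1) \<in> configs N m"
    using assms by (auto simp: configs_def strict_mono_on_def)
  then show ?thesis by blast
qed

lemma lattice_pt_less:
  assumes q: "0 < q" "q < 1" and u: "0 \<le> u" "u < 1" and xy: "x < y"
  shows "lattice_pt q u x < lattice_pt q u y"
proof -
  define a b where "a = q ^ x" and "b = q ^ y"
  have b: "0 < b" "b < a" "a \<le> 1"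
    using q xy by (auto simp: a_def b_def power_strict_decreasing power_le_one)
  have ab: "0 < a * b" using b by simp
  have "a * b < 1 * 1" by (rule mult_le_less_imp_less) (use b in auto)
  then have "u * (a * b) < 1"
    using u ab by (smt (verit) mult_left_le_one_le)
  then have "u < 1 / (a * b)"
    using ab by (simp add: pos_less_divide_eq)
  then have "(a - b) * u < (a - b) * (1 / (a * b))"
    using b by (intro mult_strict_left_mono) auto
  also have "\<dots> = 1 / b - 1 / a"
    using b by (simp add: field_simps)
  finally have "1 / a + u * a < 1 / b + u * b"
    by (simp add: algebra_simps)
  then show ?thesis
    by (simp add: lattice_pt_def power_int_minus a_def b_def divide_simps)
qed

lemma gas_weight_pos:
  assumes q: "0 < q" "q < 1" and u: "0 \<le> u" "u < 1" and "\<mu> \<in> configs N m"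
  shows "0 < gas_weight N q u V \<mu>"
proof -
  have ne: "lattice_pt q u (\<mu> i) - lattice_pt q u (\<mu> j) \<noteq> 0" if "1 \<le> i" "i < j" "j \<le> N" for i j
    using lattice_pt_less[OF q u, of "\<mu> i" "\<mu> j"] that assms(5)
    by (auto simp: configs_def strict_mono_on_def)
  show ?thesis
    unfolding gas_weight_def
    by (intro mult_pos_pos prod_pos) (use ne in \<open>force simp: weight_def\<close>)+
qed

lemma prob_space_log_gas:
  assumes q: "0 < q" "q < 1" and u: "0 \<le> u" "u < 1" and "N \<le> m + 1"
  shows "prob_space (log_gas N q u m V)"
proof
  let ?Z = "\<Sum>\<nu>\<in>configs N m. gas_weight N q u V \<nu>"
  have Z: "0 < ?Z"
    using gas_weight_pos[OF q u] finite_configs configs_nonempty[OF assms(5)]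
    by (intro sum_pos) auto
  have "emeasure (log_gas N q u m V) (space (log_gas N q u m V)) =
      (\<Sum>\<nu>\<in>configs N m. ennreal (gas_weight N q u V \<nu> / ?Z))"
    by (simp add: log_gas_def space_point_measure emeasure_point_measure_finite finite_configs)
  also have "\<dots> = ennreal (\<Sum>\<nu>\<in>configs N m. gas_weight N q u V \<nu> / ?Z)"
    using Z gas_weight_pos[OF q u]
    by (intro sum_ennreal divide_nonneg_pos) (auto intro: less_imp_le)
  also have "\<dots> = 1"
    using Z by (simp flip: sum_divide_distrib)
  finally show "emeasure (log_gas N q u m V) (space (log_gas N q u m V)) = 1" .
qed

end

theory Submission
  imports "HOL-Complex_Analysis.Complex_Analysis" Defs
begin

text \<open>The only possible singularities of \<open>R\<close> are points \<open>z\<close> where \<open>\<sigma>(z)\<close> or \<open>\<sigma>(qz)\<close> is a lattice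
  point; they are simple poles. Except at the four zeros of \<open>\<Phi>\<^sup>\<plusminus>\<close>, such a \<open>z\<close> has
  \<open>\<sigma>(z) = \<ell>\<^sub>a\<close> and \<open>\<sigma>(qz) = \<ell>\<^sub>b\<close> with \<open>a\<close>, \<open>b\<close> adjacent. Moving a particle from \<open>a\<close> to \<open>b\<close> matches the
  configurations with a pole in the first expectation with those having a pole in the second,
  and the ratio condition on the weights says exactly that the matched residues cancel.

  If \<open>\<Phi>\<^sup>\<plusminus>\<close> are polynomials, then \<open>R\<close> extends to the punctured plane. Both products converge to
  finite limits at \<open>0\<close> and at infinity, so \<open>R\<close> is entire with growth at most \<open>|z|\<^sup>d\<close>, and Liouville's
  theorem applies.\<close>

section \<open>Products over pairs, simple poles and removable singularities\<close>

lemma prod_pairs_remove: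
  fixes f :: "nat \<Rightarrow> nat \<Rightarrow> 'a :: comm_monoid_mult"
  assumes "k \<in> {1..N}" and sym: "\<And>i j. f i j = f j i"
  shows "(\<Prod>(i, j)\<in>{(i, j). 1 \<le> i \<and> i < j \<and> j \<le> N}. f i j) =
    (\<Prod>i\<in>{1..N} - {k}. f k i) *
    (\<Prod>(i, j)\<in>{(i, j). 1 \<le> i \<and> i < j \<and> j \<le> N \<and> i \<noteq> k \<and> j \<noteq> k}. f i j)"
proof -
  let ?P = "{(i, j). 1 \<le> i \<and> i < j \<and> j \<le> N}"
  let ?K = "{(i, j). 1 \<le> i \<and> i < j \<and> j \<le> N \<and> (i = k \<or> j = k)}"
  let ?R = "{(i, j). 1 \<le> i \<and> i < j \<and> j \<le> N \<and> i \<noteq> k \<and> j \<noteq> k}"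
  have "finite ?P"
    by (rule finite_subset[of _ "{1..N} \<times> {1..N}"]) auto
  then have fin: "finite ?K" "finite ?R"
    by (auto elim!: rev_finite_subset)
  have "?P = ?K \<union> ?R" by auto
  then have "(\<Prod>(i, j)\<in>?P. f i j) = (\<Prod>(i, j)\<in>?K \<union> ?R. f i j)"
    by simp
  also have "\<dots> = (\<Prod>(i, j)\<in>?K. f i j) * (\<Prod>(i, j)\<in>?R. f i j)"
    by (rule prod.union_disjoint[OF fin]) auto
  \<comment> \<open>A pair containing \<open>k\<close> is determined by its other index
    \<open>i\<close>; \<open>sym\<close> makes the order within the pair irrelevant.\<close>
  also have "(\<Prod>(i, j)\<in>?K. f i j) = (\<Prod>i\<in>{1..N} - {k}. f k i)"
    by (rule prod.reindex_bij_witness[where i = "\<lambda>i. (min i k, max i k)"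
          and j = "\<lambda>(i, j). if i = k then j else i"])
       (use assms(1) in \<open>auto simp: min_def max_def intro: sym split: if_splits\<close>)
  finally show ?thesis .
qed

text \<open>Only the factor \<open>k\<close> has a denominator vanishing at \<open>z0\<close>, and
  \<open>d\<close> acts as the derivative of that denominator. The zero is simple, so
  \<open>z - z0\<close> cancels it while all other factors converge.\<close>

lemma tendsto_prod_quotient_pole:
  fixes f g :: "'i \<Rightarrow> 'a :: real_normed_field \<Rightarrow> 'a"
  assumes fin: "finite I" and k: "k \<in> I"
    and f: "\<And>i. i \<in> I \<Longrightarrow> (f i \<longlongrightarrow> a i) (at z0)"
    and g: "\<And>i. i \<in> I - {k} \<Longrightarrow> (g i \<longlongrightarrow> b i) (at z0)"
    and nz: "\<And>i. i \<in> I - {k} \<Longrightarrow> b i \<noteq> 0"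
    and gk: "((\<lambda>z. g k z / (z - z0)) \<longlongrightarrow> d) (at z0)" and d: "d \<noteq> 0"
  shows "((\<lambda>z. (z - z0) * (\<Prod>i\<in>I. f i z / g i z)) \<longlongrightarrow>
    a k / d * (\<Prod>i\<in>I - {k}. a i / b i)) (at z0)"
proof -
  have "((\<lambda>z. f k z / (g k z / (z - z0)) * (\<Prod>i\<in>I - {k}. f i z / g i z)) \<longlongrightarrow>
      a k / d * (\<Prod>i\<in>I - {k}. a i / b i)) (at z0)"
    using assms by (intro tendsto_intros) auto
  then show ?thesis
    by (simp add: prod.remove[OF fin k] mult_ac divide_simps)
qed

text \<open>Riemann's theorem on removable singularities, applied to one point at a time. At a
  simple pole the limit in \<open>lim\<close> would be the residue.\<close>

lemma holomorphic_on_extend_finite: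
  fixes f :: "complex \<Rightarrow> complex"
  assumes "finite E" and S: "open S" and hol: "f holomorphic_on S - E"
    and lim: "\<And>z. z \<in> E \<inter> S \<Longrightarrow> ((\<lambda>w. (w - z) * f w) \<longlongrightarrow> 0) (at z)"
  shows "\<exists>g. g holomorphic_on S \<and> (\<forall>z\<in>S - E. g z = f z)"
  using assms(1) hol lim
proof (induction E arbitrary: f rule: finite_induct)
  case empty
  then show ?case by auto
next
  case (insert x E)
  have op: "open (S - E)"
    using S insert.hyps by (simp add: open_Diff finite_imp_closed)
  obtain h where h: "h holomorphic_on S - E" "\<And>z. z \<in> S - insert x E \<Longrightarrow> h z = f z"
  proof (cases "x \<in> S")
    case False
    then show ?thesis using that insert.prems(1) by (metis Diff_insert0 Diff_insert)
  next
    case True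
    then have "x \<in> interior (S - E)"
      using insert.hyps by (simp add: interior_open op)
    moreover have "f holomorphic_on (S - E) - {x}"
      using insert.prems(1) by (metis Diff_insert)
    ultimately have "\<exists>g. g holomorphic_on (S - E) \<and> (\<forall>z\<in>(S - E) - {x}. g z = f z)"
      using holomorphic_on_extend_lim insert.prems(2)[of x] True by blast
    then show ?thesis using that by blast
  qed
  \<comment> \<open>The partial extension \<open>h\<close> equals \<open>f\<close> near
    \<open>z\<close>, except perhaps at \<open>z\<close> itself, so it inherits the limit condition
    at the points still to be filled.\<close>
  have "((\<lambda>w. (w - z) * h w) \<longlongrightarrow> 0) (at z)" if z: "z \<in> E \<inter> S" for z
  proof (rule Lim_transform_eventually)
    show "((\<lambda>w. (w - z) * f w) \<longlongrightarrow> 0) (at z)" using insert.prems(2) z by blast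
    have "open (S - (insert x E - {z}))"
      using S insert.hyps by (simp add: open_Diff finite_imp_closed)
    then have "\<forall>\<^sub>F w in at z. w \<in> S - (insert x E - {z}) - {z}"
      by (intro eventually_at_in_open) (use z in auto)
    then show "\<forall>\<^sub>F w in at z. (w - z) * f w = (w - z) * h w"
      by eventually_elim (use h(2) in auto)
  qed
  from insert.IH[OF h(1) this] h(2) show ?case
    by (metis Diff_iff insertCI)
qed

section \<open>Moving one particle to a neighbouring site\<close>

text \<open>The factors of \<open>gas_weight\<close> that do not involve particle \<open>k\<close>;
  they survive a move of that particle unchanged.\<close>

definition spectator_weight ::
    "nat \<Rightarrow> real \<Rightarrow> real \<Rightarrow> (real \<Rightarrow> real) \<Rightarrow> (nat \<Rightarrow> nat) \<Rightarrow> nat \<Rightarrow> real" where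
  "spectator_weight N q u V \<mu> k =
     (\<Prod>(i, j)\<in>{(i, j). 1 \<le> i \<and> i < j \<and> j \<le> N \<and> i \<noteq> k \<and> j \<noteq> k}.
        (lattice_pt q u (\<mu> i) - lattice_pt q u (\<mu> j)) ^ 2) *
     (\<Prod>i\<in>{1..N} - {k}. weight N V (lattice_pt q u (\<mu> i)))"

lemma spectator_weight_fun_upd [simp]:
  "spectator_weight N q u V (\<mu>(k := b)) k = spectator_weight N q u V \<mu> k"
  unfolding spectator_weight_def by (intro arg_cong2[of _ _ _ _ times] prod.cong) auto

lemma gas_weight_split:
  assumes k: "k \<in> {1..N}"
  shows "gas_weight N q u V \<mu> = weight N V (lattice_pt q u (\<mu> k)) *
    (\<Prod>i\<in>{1..N} - {k}. (lattice_pt q u (\<mu> k) - lattice_pt q u (\<mu> i)) ^ 2) *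
    spectator_weight N q u V \<mu> k"
  unfolding gas_weight_def spectator_weight_def
  using prod_pairs_remove[OF k, of "\<lambda>i j. (lattice_pt q u (\<mu> i) - lattice_pt q u (\<mu> j)) ^ 2"]
    prod.remove[OF _ k, of "\<lambda>i. weight N V (lattice_pt q u (\<mu> i))"]
  by (simp add: power2_commute mult_ac)

text \<open>A jump to a vacant adjacent site overtakes no other particle, so the order of the labels
  is preserved.\<close>

lemma configs_fun_upd:
  assumes \<mu>: "\<mu> \<in> configs N m" and k: "k \<in> {1..N}" and b: "b \<le> m" "b \<notin> \<mu> ` {1..N}"
    and adj: "\<mu> k = Suc b \<or> b = Suc (\<mu> k)"
  shows "\<mu>(k := b) \<in> configs N m"
proof -
  have mono: "\<mu> i < \<mu> j" if "i \<in> {1..N}" "j \<in> {1..N}" "i < j" for i j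
    using \<mu> that by (auto simp: configs_def strict_mono_on_def)
  have ne: "\<mu> i \<noteq> b" if "i \<in> {1..N}" for i
    using b(2) that by auto
  have "strict_mono_on {1..N} (\<mu>(k := b))"
  proof (rule strict_mono_onI)
    fix i j assume ij: "i \<in> {1..N}" "j \<in> {1..N}" "i < j"
    show "(\<mu>(k := b)) i < (\<mu>(k := b)) j"
      using mono[OF ij] ne[OF ij(1)] ne[OF ij(2)] adj ij(3) by auto
  qed
  moreover have "\<mu>(k := b) \<in> {1..N} \<rightarrow>\<^sub>E {0..m}"
    using \<mu> k b(1) by (auto simp: configs_def PiE_iff extensional_def)
  ultimately show ?thesis by (simp add: configs_def)
qed

text \<open>What the residues at a pole \<open>\<ell>\<^sub>a\<close> of the first product and \<open>\<ell>\<^sub>b\<close> of the second have in common: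
  one factor of the squared Vandermonde determinant is used up by the denominators.\<close>

definition pair_weight ::
    "nat \<Rightarrow> real \<Rightarrow> real \<Rightarrow> nat \<Rightarrow> (real \<Rightarrow> real) \<Rightarrow> nat \<Rightarrow> nat \<Rightarrow> real" where
  "pair_weight N q u m V a b =
     (\<Sum>(\<mu>, k)\<in>{(\<mu>, k). \<mu> \<in> configs N m \<and> k \<in> {1..N} \<and> \<mu> k = a \<and> b \<notin> \<mu> ` {1..N}}.
        spectator_weight N q u V \<mu> k *
        (\<Prod>i\<in>{1..N} - {k}. (lattice_pt q u a - lattice_pt q u (\<mu> i)) *
                            (lattice_pt q u b - lattice_pt q u (\<mu> i))))"

text \<open>The move of particle \<open>k\<close> from \<open>a\<close> to \<open>b\<close> is a
  bijection between the two index sets, inverted by the move back. Each summand is preserved, since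
  its product is symmetric in \<open>a\<close> and \<open>b\<close> and the spectators stay where
  they are.\<close>

lemma pair_weight_commute:
  assumes ab: "a \<le> m" "b \<le> m" and adj: "a = Suc b \<or> b = Suc a"
  shows "pair_weight N q u m V a b = pair_weight N q u m V b a"
  unfolding pair_weight_def
proof (rule sum.reindex_bij_witness[where i = "\<lambda>(\<mu>, k). (\<mu>(k := a), k)"
      and j = "\<lambda>(\<mu>, k). (\<mu>(k := b), k)"], goal_cases)
  case (1 x)
  then show ?case by auto
next
  case (2 x)
  then obtain \<mu> k where x: "x = (\<mu>, k)" "\<mu> \<in> configs N m" "k \<in> {1..N}" "\<mu> k = a" "b \<notin> \<mu> ` {1..N}"
    by auto
  then have "\<mu>(k := b) \<in> configs N m"
    using configs_fun_upd[of \<mu> N m k b] ab adj by auto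
  \<comment> \<open>Particles occupy distinct sites, so the departure of \<open>k\<close> leaves
    \<open>a\<close> vacant.\<close>
  moreover have "\<mu> i \<noteq> a" if "i \<in> {1..N}" "i \<noteq> k" for i
    using x(2-4) that by (auto simp: configs_def dest!: strict_mono_on_imp_inj_on dest: inj_onD)
  then have "\<forall>i\<in>{1..N}. (\<mu>(k := b)) i \<noteq> a"
    using adj by auto
  then have "a \<notin> (\<mu>(k := b)) ` {1..N}"
    by (metis imageE)
  ultimately show ?case using x by simp
next
  case (3 x)
  then show ?case by auto
next
  case (4 x)
  then obtain \<mu> k where x: "x = (\<mu>, k)" "\<mu> \<in> configs N m" "k \<in> {1..N}" "\<mu> k = b" "a \<notin> \<mu> ` {1..N}"
    by auto
  then have "\<mu>(k := a) \<in> configs N m"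
    using configs_fun_upd[of \<mu> N m k a] ab adj by auto
  moreover have "\<mu> i \<noteq> b" if "i \<in> {1..N}" "i \<noteq> k" for i
    using x(2-4) that by (auto simp: configs_def dest!: strict_mono_on_imp_inj_on dest: inj_onD)
  then have "\<forall>i\<in>{1..N}. (\<mu>(k := a)) i \<noteq> b"
    using adj by auto
  then have "b \<notin> (\<mu>(k := a)) ` {1..N}"
    by (metis imageE)
  ultimately show ?case using x by simp
next
  case (5 x)
  then show ?case by (auto simp: mult_ac intro!: prod.cong)
qed

text \<open>In every term one of the two factors
  \<open>lattice_pt q u a - lattice_pt q u (\<mu> i)\<close> of the squared Vandermonde determinant
  cancels the denominator.\<close>

lemma sum_residues_eq_pair_weight:
  assumes q: "0 < q" "q < 1" and u: "0 \<le> u" "u < 1" and "a \<noteq> b"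
  shows "(\<Sum>\<mu>\<in>configs N m. gas_weight N q u V \<mu> *
      (\<Sum>k\<in>{k \<in> {1..N}. \<mu> k = a}. \<Prod>i\<in>{1..N} - {k}.
        (lattice_pt q u b - lattice_pt q u (\<mu> i)) / (lattice_pt q u a - lattice_pt q u (\<mu> i)))) =
    weight N V (lattice_pt q u a) * pair_weight N q u m V a b"
    (is "(\<Sum>\<mu>\<in>?C. ?g \<mu> * (\<Sum>k\<in>?K \<mu>. \<Prod>i\<in>?I k. (?l b - ?l (\<mu> i)) / (?l a - ?l (\<mu> i)))) = _")
proof -
  let ?X = "{(\<mu>, k). \<mu> \<in> configs N m \<and> k \<in> {1..N} \<and> \<mu> k = a \<and> b \<notin> \<mu> ` {1..N}}"
  let ?s = "\<lambda>\<mu> k. spectator_weight N q u V \<mu> k *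
    (\<Prod>i\<in>?I k. (?l a - ?l (\<mu> i)) * (?l b - ?l (\<mu> i)))"
  have step: "?g \<mu> * (\<Prod>i\<in>?I k. (?l b - ?l (\<mu> i)) / (?l a - ?l (\<mu> i))) =
      weight N V (?l a) * ?s \<mu> k" if "\<mu> \<in> ?C" "k \<in> ?K \<mu>" for \<mu> k
  proof -
    have k: "k \<in> {1..N}" "\<mu> k = a" using that by auto
    have ne: "?l a - ?l (\<mu> i) \<noteq> 0" if "i \<in> ?I k" for i
    proof -
      have "\<mu> i \<noteq> a"
        using \<open>\<mu> \<in> ?C\<close> k that
        by (auto simp: configs_def dest!: strict_mono_on_imp_inj_on dest: inj_onD)
      then show ?thesis
        using lattice_pt_less[OF q u, of "\<mu> i" a] lattice_pt_less[OF q u, of a "\<mu> i"] by linarith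
    qed
    have "(\<Prod>i\<in>?I k. (?l a - ?l (\<mu> i)) ^ 2) * (\<Prod>i\<in>?I k. (?l b - ?l (\<mu> i)) / (?l a - ?l (\<mu> i))) =
        (\<Prod>i\<in>?I k. (?l a - ?l (\<mu> i)) * (?l b - ?l (\<mu> i)))"
      unfolding prod.distrib[symmetric]
      by (rule prod.cong) (use ne in \<open>auto simp: power2_eq_square\<close>)
    then show ?thesis
      by (simp add: gas_weight_split[OF k(1)] k(2) mult_ac)
  qed
  have "(\<Sum>\<mu>\<in>?C. ?g \<mu> * (\<Sum>k\<in>?K \<mu>. \<Prod>i\<in>?I k. (?l b - ?l (\<mu> i)) / (?l a - ?l (\<mu> i)))) =
      (\<Sum>\<mu>\<in>?C. \<Sum>k\<in>?K \<mu>. weight N V (?l a) * ?s \<mu> k)"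
    unfolding sum_distrib_left by (intro sum.cong refl) (use step in auto)
  also have "\<dots> = (\<Sum>(\<mu>, k)\<in>Sigma ?C ?K. weight N V (?l a) * ?s \<mu> k)"
    by (rule sum.Sigma) (auto simp: finite_configs)
  \<comment> \<open>A second particle sitting at \<open>b\<close> puts a zero factor into the
    numerator, so only configurations with \<open>b\<close> vacant contribute.\<close>
  also have "\<dots> = (\<Sum>(\<mu>, k)\<in>?X. weight N V (?l a) * ?s \<mu> k)"
  proof (rule sum.mono_neutral_right)
    show "finite (Sigma ?C ?K)" by (auto simp: finite_configs)
    show "?X \<subseteq> Sigma ?C ?K" by auto
    show "\<forall>x\<in>Sigma ?C ?K - ?X. (case x of (\<mu>, k) \<Rightarrow> weight N V (?l a) * ?s \<mu> k) = 0"
    proof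
      fix x assume "x \<in> Sigma ?C ?K - ?X"
      then obtain \<mu> k where x: "x = (\<mu>, k)" "\<mu> \<in> ?C" "k \<in> {1..N}" "\<mu> k = a" "b \<in> \<mu> ` {1..N}"
        by auto
      from x(5) obtain j where j: "j \<in> {1..N}" "\<mu> j = b"
        by blast
      then have "j \<in> ?I k" using x(4) \<open>a \<noteq> b\<close> by auto
      then have "(\<Prod>i\<in>?I k. (?l a - ?l (\<mu> i)) * (?l b - ?l (\<mu> i))) = 0"
        using j(2) by (intro prod_zero) auto
      then show "(case x of (\<mu>, k) \<Rightarrow> weight N V (?l a) * ?s \<mu> k) = 0"
        unfolding x(1) by (simp only: mult_zero_right prod.case)
    qed
  qed
  also have "\<dots> = weight N V (?l a) * pair_weight N q u m V a b"
    by (simp add: pair_weight_def sum_distrib_left case_prod_unfold)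
  finally show ?thesis .
qed

section \<open>Polynomial growth, and expectations as finite sums\<close>

lemma poly_bigo_at_infinity:
  fixes p :: "complex poly"
  assumes "degree p \<le> d"
  shows "poly p \<in> O[at_infinity](\<lambda>z. z ^ d)"
proof -
  have "(\<lambda>z :: complex. coeff p i * z ^ i) \<in> O[at_infinity](\<lambda>z. z ^ d)" if "i \<le> degree p" for i
  proof (rule bigoI)
    show "\<forall>\<^sub>F z :: complex in at_infinity. norm (coeff p i * z ^ i) \<le> norm (coeff p i) * norm (z ^ d)"
      unfolding eventually_at_infinity norm_mult norm_power
      using that assms by (intro exI[of _ 1] allI impI mult_left_mono power_increasing) auto
  qed
  then have "(\<lambda>z. \<Sum>i\<le>degree p. coeff p i * z ^ i) \<in> O[at_infinity](\<lambda>z. z ^ d)"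
    by (intro big_sum_in_bigo) auto
  moreover have "poly p = (\<lambda>z. \<Sum>i\<le>degree p. coeff p i * z ^ i)"
    by (simp add: poly_altdef fun_eq_iff)
  ultimately show ?thesis by simp
qed

lemma entire_bigo_power_imp_poly:
  fixes f :: "complex \<Rightarrow> complex"
  assumes hol: "f holomorphic_on UNIV" and "f \<in> O[at_infinity](\<lambda>z. z ^ d)"
  shows "\<exists>r. degree r \<le> d \<and> (\<forall>z. f z = poly r z)"
proof -
  obtain B A where AB: "\<And>z. A \<le> norm z \<Longrightarrow> norm (f z) \<le> B * norm z ^ d"
    using assms(2) by (elim landau_o.bigE) (auto simp: eventually_at_infinity norm_power)
  \<comment> \<open>The Taylor polynomial of \<open>f\<close> at 0, truncated at degree
    \<open>d\<close>; the growth bound kills all higher coefficients.\<close>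
  let ?r = "\<Sum>k\<le>d. monom ((deriv ^^ k) f 0 / fact k) k"
  have "degree ?r \<le> d"
    by (intro degree_sum_le) (auto intro: order_trans[OF degree_monom_le])
  moreover have "f z = poly ?r z" for z
    using Liouville_polynomial[OF hol AB, where \<xi> = z] by (simp add: poly_sum poly_monom)
  ultimately show ?thesis by blast
qed

text \<open>The state space is finite, so the expectations are finite sums over configurations, and
  limits, holomorphy and growth bounds can be treated term by term.\<close>

lemma nekrasov_R_eq_sum:
  fixes N m :: nat and V :: "real \<Rightarrow> real"
  assumes q: "0 < q" "q < 1" and u: "0 \<le> u" "u < 1"
  defines "Z \<equiv> (\<Sum>\<nu>\<in>configs N m. gas_weight N q u V \<nu>)"
  shows "nekrasov_R N q u m V \<Phi>p \<Phi>m z = (\<Sum>\<mu>\<in>configs N m. of_real (gas_weight N q u V \<mu> / Z) *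
     (\<Phi>m z * (\<Prod>i = 1..N. (sigma u (q * z) - of_real (lattice_pt q u (\<mu> i))) /
                       (sigma u z - of_real (lattice_pt q u (\<mu> i)))) +
      \<Phi>p z * (\<Prod>i = 1..N. (sigma u z - of_real (lattice_pt q u (\<mu> i))) /
                       (sigma u (q * z) - of_real (lattice_pt q u (\<mu> i))))))"
proof -
  have "0 \<le> gas_weight N q u V \<mu> / Z" if "\<mu> \<in> configs N m" for \<mu>
    unfolding Z_def using that gas_weight_pos[OF q u]
    by (intro divide_nonneg_nonneg sum_nonneg) (auto intro: less_imp_le)
  then show ?thesis
    unfolding nekrasov_R_def log_gas_def Z_def[symmetric]
    by (subst (1 2) lebesgue_integral_point_measure_finite)
       (auto simp: finite_configs scaleR_conv_of_real sum_distrib_left algebra_simps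
          simp flip: sum.distrib intro!: sum.cong)
qed

section \<open>Preimages of lattice points under \<open>sigma\<close>\<close>

text \<open>With \<open>u\<close> strictly positive, each lattice point has two preimages under
  \<open>sigma u\<close>, both nonzero. In the theorem the strictness comes from the conditions on
  \<open>D\<close>.\<close>

locale q_lattice =
  fixes q u :: real
  assumes q: "0 < q" "q < 1" and u: "0 < u" "u < 1"
begin

lemma u0: "0 \<le> u"
  using u by simp

abbreviation site :: "nat \<Rightarrow> complex" where
  "site x \<equiv> of_real (lattice_pt q u x)"

abbreviation quot :: "nat \<Rightarrow> (nat \<Rightarrow> nat) \<Rightarrow> complex \<Rightarrow> complex \<Rightarrow> complex" where
  "quot N \<mu> s t \<equiv> \<Prod>i = 1..N. (s - site (\<mu> i)) / (t - site (\<mu> i))"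

lemma lattice_pt_eq_iff: "lattice_pt q u x = lattice_pt q u y \<longleftrightarrow> x = y"
  using lattice_pt_less[OF q u0 u(2), of x y] lattice_pt_less[OF q u0 u(2), of y x]
  by (cases x y rule: linorder_cases) auto

text \<open>Multiplied by \<open>z\<close>, the equation becomes quadratic; its two roots have
  product \<open>u\<close>.\<close>

lemma sigma_eq_site_iff:
  "sigma u z = site x \<longleftrightarrow> z = of_real (inverse (q ^ x)) \<or> z = of_real (u * q ^ x)"
proof (cases "z = 0")
  case True
  \<comment> \<open>By the convention \<open>inverse 0 = 0\<close>, \<open>sigma u 0\<close> is 0,
    which is not a lattice point; neither of the two roots is 0 either.\<close>
  have "0 < lattice_pt q u x"
    using q u by (auto simp: lattice_pt_def intro!: add_pos_pos)
  then show ?thesis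
    using True q u by (auto simp: sigma_def)
next
  case False
  have "(z - of_real (inverse (q ^ x))) * (z - of_real (u * q ^ x)) = z * (sigma u z - site x)"
    using False q by (simp add: sigma_def lattice_pt_def power_int_minus algebra_simps)
  then show ?thesis
    using False by (metis eq_iff_diff_eq_0 mult_eq_0_iff)
qed

lemma sigma_site_nonzero: "sigma u z = site x \<Longrightarrow> z \<noteq> 0"
  using sigma_eq_site_iff q u by auto

text \<open>The critical points of \<open>sigma u\<close> are the square roots of \<open>u\<close>.
  Of the two preimages of a lattice point one is at least 1 and the other at most \<open>u\<close>,
  so both avoid them. This is why the poles are simple.\<close>

lemma sigma_site_not_critical:
  assumes "sigma u z = site x"
  shows "z ^ 2 \<noteq> of_real u"
proof -
  have p: "0 < q ^ x" "q ^ x \<le> 1"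
    using q by (auto intro: power_le_one)
  have 1: "u < inverse (q ^ x) ^ 2"
  proof -
    have "1 \<le> inverse (q ^ x)" using p by (simp add: one_le_inverse)
    then have "1 \<le> inverse (q ^ x) ^ 2" by (rule one_le_power)
    then show ?thesis using u by linarith
  qed
  have 2: "(u * q ^ x) ^ 2 < u"
  proof -
    have "(q ^ x) ^ 2 \<le> 1" by (rule power_le_one) (use p in auto)
    then have "u ^ 2 * (q ^ x) ^ 2 \<le> u ^ 2" using u by (intro mult_left_le) auto
    moreover have "u ^ 2 < u" using u by (simp add: power2_eq_square)
    ultimately show ?thesis unfolding power_mult_distrib by linarith
  qed
  have "(of_real r :: complex) ^ 2 \<noteq> of_real u" if "r ^ 2 \<noteq> u" for r
    using that by (metis of_real_eq_iff of_real_power)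
  then show ?thesis
    using assms[unfolded sigma_eq_site_iff] 1 2 by (metis less_irrefl)
qed

lemma DERIV_sigma:
  fixes z :: complex
  assumes "z \<noteq> 0"
  shows "(sigma u has_field_derivative (z ^ 2 - u) / z ^ 2) (at z)"
  unfolding sigma_def using assms
  by (auto intro!: derivative_eq_intros simp: field_simps power2_eq_square)

lemma sigma_site_quotient:
  fixes z :: complex
  assumes "sigma u z = site x"
  shows "((\<lambda>w. (sigma u w - site x) / (w - z)) \<longlongrightarrow> (z ^ 2 - u) / z ^ 2) (at z)"
  using DERIV_sigma[OF sigma_site_nonzero[OF assms]] assms
  by (simp add: has_field_derivative_iff)

lemma sigma_site_quotient_dilated:
  fixes z :: complex
  assumes "sigma u (q * z) = site x"
  shows "((\<lambda>w. (sigma u (q * w) - site x) / (w - z)) \<longlongrightarrow>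
    (q ^ 2 * z ^ 2 - u) / (q * z ^ 2)) (at z)"
proof -
  have "((\<lambda>w. sigma u (q * w)) has_field_derivative
      ((q * z) ^ 2 - u) / (q * z) ^ 2 * of_real q) (at z)"
    by (rule DERIV_chain2[where f = "sigma u" and g = "\<lambda>w. of_real q * w" and x = z, OF DERIV_sigma[OF sigma_site_nonzero[OF assms]]])
       (auto intro!: derivative_eq_intros)
  moreover have "((q * z) ^ 2 - u) / (q * z) ^ 2 * of_real q = (q ^ 2 * z ^ 2 - u) / (q * z ^ 2)"
    using q sigma_site_nonzero[OF assms] by (simp add: field_simps power2_eq_square)
  ultimately show ?thesis
    using assms by (simp add: has_field_derivative_iff)
qed

lemma tendsto_sigma: "z \<noteq> 0 \<Longrightarrow> (sigma u \<longlongrightarrow> sigma u z) (at z)"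
  using DERIV_isCont[OF DERIV_sigma] by (simp add: isCont_def)

lemma tendsto_sigma_dilated:
  fixes z :: complex
  assumes "z \<noteq> 0"
  shows "((\<lambda>w. sigma u (q * w)) \<longlongrightarrow> sigma u (q * z)) (at z)"
  unfolding sigma_def using assms q by (intro tendsto_intros) auto

section \<open>Residues of the two products, and their cancellation\<close>

text \<open>Particles occupy distinct sites, so the sum over \<open>k\<close> has at most one term.
  Writing it as a sum also covers a vacant site \<open>a\<close>, where there is no pole and the
  limit is 0.\<close>

lemma residue_quotient:
  fixes s t :: "complex \<Rightarrow> complex"
  assumes \<mu>: "\<mu> \<in> configs N m"
    and s: "(s \<longlongrightarrow> s0) (at z)" and t: "(t \<longlongrightarrow> site a) (at z)"
    and d: "((\<lambda>w. (t w - site a) / (w - z)) \<longlongrightarrow> d) (at z)" "d \<noteq> 0"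
  shows "((\<lambda>w. (w - z) * quot N \<mu> (s w) (t w)) \<longlongrightarrow>
     (s0 - site a) / d * (\<Sum>k\<in>{k \<in> {1..N}. \<mu> k = a}. \<Prod>i\<in>{1..N} - {k}.
        (s0 - site (\<mu> i)) / (site a - site (\<mu> i)))) (at z)"
proof (cases "\<exists>k\<in>{1..N}. \<mu> k = a")
  case False
  then have "{k \<in> {1..N}. \<mu> k = a} = {}" by auto
  moreover have "((\<lambda>w. (w - z) * quot N \<mu> (s w) (t w)) \<longlongrightarrow>
     (z - z) * quot N \<mu> s0 (site a)) (at z)"
    using False s t by (intro tendsto_intros) (auto simp: lattice_pt_eq_iff)
  ultimately show ?thesis by (simp only: sum.empty) simp
next
  case True
  then obtain k where k: "k \<in> {1..N}" "\<mu> k = a" by auto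
  have inj: "\<mu> i \<noteq> a" if "i \<in> {1..N} - {k}" for i
    using \<mu> k that by (auto simp: configs_def dest!: strict_mono_on_imp_inj_on dest: inj_onD)
  then have "{k \<in> {1..N}. \<mu> k = a} = {k}" using k by auto
  moreover have "((\<lambda>w. (w - z) * quot N \<mu> (s w) (t w)) \<longlongrightarrow>
     (s0 - site (\<mu> k)) / d * (\<Prod>i\<in>{1..N} - {k}. (s0 - site (\<mu> i)) / (site a - site (\<mu> i)))) (at z)"
  proof (rule tendsto_prod_quotient_pole[OF finite_atLeastAtMost k(1)])
    fix i assume "i \<in> {1..N}"
    show "((\<lambda>w. s w - site (\<mu> i)) \<longlongrightarrow> s0 - site (\<mu> i)) (at z)"
      by (intro tendsto_intros s)
  next
    fix i assume "i \<in> {1..N} - {k}"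
    then show "site a - site (\<mu> i) \<noteq> 0"
      using inj[of i] by (auto simp: lattice_pt_eq_iff)
    show "((\<lambda>w. t w - site (\<mu> i)) \<longlongrightarrow> site a - site (\<mu> i)) (at z)"
      by (intro tendsto_intros t)
  qed (use d k in auto)
  ultimately show ?thesis using k by simp
qed

lemma quotient_regular:
  fixes s t :: "complex \<Rightarrow> complex"
  assumes \<mu>: "\<mu> \<in> configs N m"
    and s: "(s \<longlongrightarrow> s0) (at z)" and t: "(t \<longlongrightarrow> t0) (at z)"
    and reg: "\<forall>x\<le>m. t0 \<noteq> site x"
  shows "((\<lambda>w. (w - z) * quot N \<mu> (s w) (t w)) \<longlongrightarrow> 0) (at z)"
proof -
  have "\<mu> i \<le> m" if "i \<in> {1..N}" for i
    using \<mu> that by (auto simp: configs_def PiE_iff)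
  then have "((\<lambda>w. (w - z) * quot N \<mu> (s w) (t w)) \<longlongrightarrow>
     (z - z) * quot N \<mu> s0 t0) (at z)"
    using s t reg by (intro tendsto_intros) auto
  then show ?thesis by simp
qed

text \<open>With \<open>c = w - z\<close> this form exposes the residues at \<open>z\<close>; with
  \<open>c = 1\<close> it serves for holomorphy and growth.\<close>

lemma mult_nekrasov_R:
  fixes c w :: complex
  shows "c * nekrasov_R N q u m V \<Phi>p \<Phi>m w =
    (\<Sum>\<mu>\<in>configs N m. of_real (gas_weight N q u V \<mu> / (\<Sum>\<nu>\<in>configs N m. gas_weight N q u V \<nu>)) *
      (\<Phi>m w * (c * quot N \<mu> (sigma u (q * w)) (sigma u w)) +
       \<Phi>p w * (c * quot N \<mu> (sigma u w) (sigma u (q * w)))))"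
  unfolding nekrasov_R_eq_sum[OF q u0 u(2)] sum_distrib_left
  by (intro sum.cong refl) (simp only: distrib_left mult.left_commute)

text \<open>After summation over configurations the residues of both products share the factor
  \<open>pair_weight\<close> and carry \<open>site b - site a\<close> with opposite signs. What
  remains is a difference of site weights, each multiplied by a value of \<open>\<Phi>m\<close> or
  \<open>\<Phi>p\<close> and divided by a derivative of \<open>sigma\<close>; \<open>ratio\<close>,
  in cross-multiplied form, makes it vanish.\<close>

lemma residue_pair_cancel:
  fixes z :: complex
  assumes ab: "a \<le> m" "b \<le> m" "a = Suc b \<or> b = Suc a"
    and a: "sigma u z = site a" and b: "sigma u (q * z) = site b"
    and cont: "isCont \<Phi>p z" "isCont \<Phi>m z"
    and ratio: "of_real (weight N V (lattice_pt q u a)) * ((q ^ 2 * z ^ 2 - u) * \<Phi>m z) =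
      of_real (weight N V (lattice_pt q u b)) * (q * (z ^ 2 - u) * \<Phi>p z)"
  shows "((\<lambda>w. (w - z) * nekrasov_R N q u m V \<Phi>p \<Phi>m w) \<longlongrightarrow> 0) (at z)"
proof -
  define Z where "Z = (\<Sum>\<nu>\<in>configs N m. gas_weight N q u V \<nu>)"
  \<comment> \<open>The residue products as real numbers, so that
    \<open>sum_residues_eq_pair_weight\<close> applies after summation over configurations.\<close>
  define S where "S = (\<lambda>(a :: nat) b \<mu>. (\<Sum>k\<in>{k \<in> {1..N}. \<mu> k = a}. \<Prod>i\<in>{1..N} - {k}.
        (lattice_pt q u b - lattice_pt q u (\<mu> i)) / (lattice_pt q u a - lattice_pt q u (\<mu> i))))"
  have z: "z \<noteq> 0" using a by (rule sigma_site_nonzero)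
  define X Y where "X = z ^ 2 - u" and "Y = q ^ 2 * z ^ 2 - u"
  define d1 d2 where "d1 = X / z ^ 2" and "d2 = Y / (q * z ^ 2)"
  have nz: "X \<noteq> 0" "Y \<noteq> 0"
    using sigma_site_not_critical[OF a] sigma_site_not_critical[OF b]
    by (auto simp: power_mult_distrib X_def Y_def)
  then have d: "d1 \<noteq> 0" "d2 \<noteq> 0"
    using z q by (auto simp: d1_def d2_def)
  note cont' = cont[unfolded isCont_def]
  have A: "((\<lambda>w. (w - z) * quot N \<mu> (sigma u (q * w)) (sigma u w))
      \<longlongrightarrow> (site b - site a) / d1 * of_real (S a b \<mu>)) (at z)" if "\<mu> \<in> configs N m" for \<mu>
    using residue_quotient[OF that tendsto_sigma_dilated[OF z] tendsto_sigma[OF z, unfolded a]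
        sigma_site_quotient[OF a, folded X_def d1_def] d(1)]
    by (simp add: b S_def)
  have B: "((\<lambda>w. (w - z) * quot N \<mu> (sigma u w) (sigma u (q * w)))
      \<longlongrightarrow> (site a - site b) / d2 * of_real (S b a \<mu>)) (at z)" if "\<mu> \<in> configs N m" for \<mu>
    using residue_quotient[OF that tendsto_sigma[OF z] tendsto_sigma_dilated[OF z, unfolded b]
        sigma_site_quotient_dilated[OF b, folded Y_def d2_def] d(2)]
    by (simp add: a S_def)
  have "((\<lambda>w. (w - z) * nekrasov_R N q u m V \<Phi>p \<Phi>m w)
      \<longlongrightarrow> (\<Sum>\<mu>\<in>configs N m. of_real (gas_weight N q u V \<mu> / Z) *
       (\<Phi>m z * ((site b - site a) / d1 * of_real (S a b \<mu>)) +
        \<Phi>p z * ((site a - site b) / d2 * of_real (S b a \<mu>))))) (at z)"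
    unfolding mult_nekrasov_R Z_def by (intro tendsto_intros cont' A B)
  also have "(\<Sum>\<mu>\<in>configs N m. of_real (gas_weight N q u V \<mu> / Z) *
       (\<Phi>m z * ((site b - site a) / d1 * of_real (S a b \<mu>)) +
        \<Phi>p z * ((site a - site b) / d2 * of_real (S b a \<mu>)))) =
      (site b - site a) / Z * (\<Phi>m z / d1 * of_real (\<Sum>\<mu>\<in>configs N m. gas_weight N q u V \<mu> * S a b \<mu>)
        - \<Phi>p z / d2 * of_real (\<Sum>\<mu>\<in>configs N m. gas_weight N q u V \<mu> * S b a \<mu>))"
    unfolding of_real_sum sum_distrib_left sum_subtractf[symmetric]
    by (intro sum.cong refl) (simp add: diff_divide_distrib algebra_simps)
  also have "\<dots> = (site b - site a) / Z * of_real (pair_weight N q u m V a b) *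
      (\<Phi>m z / d1 * of_real (weight N V (lattice_pt q u a)) -
       \<Phi>p z / d2 * of_real (weight N V (lattice_pt q u b)))"
  proof -
    have ne: "a \<noteq> b" "b \<noteq> a" using ab by auto
    show ?thesis
      unfolding S_def sum_residues_eq_pair_weight[OF q u0 u(2) ne(1)]
        sum_residues_eq_pair_weight[OF q u0 u(2) ne(2)] pair_weight_commute[OF ab]
      by (simp only: of_real_mult right_diff_distrib mult.assoc mult.commute mult.left_commute)
  qed
  \<comment> \<open>Clearing \<open>d1\<close> and \<open>d2\<close> cancels \<open>z ^ 2\<close>
    and leaves exactly \<open>ratio\<close>.\<close>
  also have "\<Phi>m z / d1 * of_real (weight N V (lattice_pt q u a)) =
       \<Phi>p z / d2 * of_real (weight N V (lattice_pt q u b))"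
    using ratio[folded X_def Y_def] nz z q by (simp add: d1_def d2_def field_simps)
  finally show ?thesis by simp
qed

text \<open>No matching between the products is used here: each has at most a simple pole at
  \<open>z\<close>, and its prefactor vanishes there whenever the pole may occur, so the two terms
  tend to 0 separately.\<close>

lemma residue_zero_or_regular:
  fixes z :: complex
  assumes z: "z \<noteq> 0" and cont: "isCont \<Phi>p z" "isCont \<Phi>m z"
    and m: "\<Phi>m z = 0 \<or> (\<forall>x\<le>m. sigma u z \<noteq> site x)"
    and p: "\<Phi>p z = 0 \<or> (\<forall>x\<le>m. sigma u (q * z) \<noteq> site x)"
  shows "((\<lambda>w. (w - z) * nekrasov_R N q u m V \<Phi>p \<Phi>m w) \<longlongrightarrow> 0) (at z)"
proof -
  define Z where "Z = (\<Sum>\<nu>\<in>configs N m. gas_weight N q u V \<nu>)"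
  note s1 = tendsto_sigma[OF z] and s2 = tendsto_sigma_dilated[OF z]
  have A: "((\<lambda>w. \<Phi>m w * ((w - z) *
      quot N \<mu> (sigma u (q * w)) (sigma u w))) \<longlongrightarrow> 0) (at z)"
    if \<mu>: "\<mu> \<in> configs N m" for \<mu>
  proof (cases "\<forall>x\<le>m. sigma u z \<noteq> site x")
    case True
    show ?thesis
      using tendsto_mult[OF cont(2)[unfolded isCont_def] quotient_regular[OF \<mu> s2 s1 True]] by simp
  next
    case False
    then obtain a where a: "sigma u z = site a" by auto
    have "(z ^ 2 - u) / z ^ 2 \<noteq> 0"
      using sigma_site_not_critical[OF a] z by auto
    from residue_quotient[OF \<mu> s2 _ sigma_site_quotient[OF a] this] s1 a
    have "((\<lambda>w. (w - z) * quot N \<mu> (sigma u (q * w)) (sigma u w)) \<longlongrightarrow>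
       (sigma u (q * z) - site a) / ((z ^ 2 - u) / z ^ 2) *
       (\<Sum>k\<in>{k \<in> {1..N}. \<mu> k = a}. \<Prod>i\<in>{1..N} - {k}.
        (sigma u (q * z) - site (\<mu> i)) / (site a - site (\<mu> i)))) (at z)" by simp
    from tendsto_mult[OF cont(2)[unfolded isCont_def] this] show ?thesis
      using m False by (simp only: mult_zero_left) auto
  qed
  have B: "((\<lambda>w. \<Phi>p w * ((w - z) *
      quot N \<mu> (sigma u w) (sigma u (q * w)))) \<longlongrightarrow> 0) (at z)"
    if \<mu>: "\<mu> \<in> configs N m" for \<mu>
  proof (cases "\<forall>x\<le>m. sigma u (q * z) \<noteq> site x")
    case True
    show ?thesis
      using tendsto_mult[OF cont(1)[unfolded isCont_def] quotient_regular[OF \<mu> s1 s2 True]] by simp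
  next
    case False
    then obtain b where b: "sigma u (q * z) = site b" by auto
    have "(q ^ 2 * z ^ 2 - u) / (q * z ^ 2) \<noteq> 0"
      using sigma_site_not_critical[OF b] z q by (auto simp: power_mult_distrib)
    from residue_quotient[OF \<mu> s1 _ sigma_site_quotient_dilated[OF b] this] s2 b
    have "((\<lambda>w. (w - z) * quot N \<mu> (sigma u w) (sigma u (q * w))) \<longlongrightarrow>
       (sigma u z - site b) / ((q ^ 2 * z ^ 2 - u) / (q * z ^ 2)) *
       (\<Sum>k\<in>{k \<in> {1..N}. \<mu> k = b}. \<Prod>i\<in>{1..N} - {k}.
        (sigma u z - site (\<mu> i)) / (site b - site (\<mu> i)))) (at z)" by simp
    from tendsto_mult[OF cont(1)[unfolded isCont_def] this] show ?thesis
      using p False by (simp only: mult_zero_left) auto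
  qed
  have "((\<lambda>w. (w - z) * nekrasov_R N q u m V \<Phi>p \<Phi>m w)
      \<longlongrightarrow> (\<Sum>\<mu>\<in>configs N m. of_real (gas_weight N q u V \<mu> / Z) * (0 + 0))) (at z)"
    unfolding mult_nekrasov_R Z_def by (intro tendsto_intros A B)
  then show ?thesis by simp
qed

section \<open>Holomorphy off the exceptional points and removability at them\<close>

lemma holomorphic_nekrasov_R:
  assumes S: "0 \<notin> S" and \<Phi>: "\<Phi>p holomorphic_on S" "\<Phi>m holomorphic_on S"
  shows "nekrasov_R N q u m V \<Phi>p \<Phi>m holomorphic_on S - exceptional_pts q u m"
proof -
  let ?E = "exceptional_pts q u m"
  have \<sigma>: "sigma u holomorphic_on S - ?E" "(\<lambda>z. sigma u (q * z)) holomorphic_on S - ?E"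
    unfolding sigma_def using S q by (auto intro!: holomorphic_intros)
  have \<Phi>': "\<Phi>p holomorphic_on S - ?E" "\<Phi>m holomorphic_on S - ?E"
    using \<Phi> by (auto elim: holomorphic_on_subset)
  have nz: "sigma u z - site (\<mu> i) \<noteq> 0" "sigma u (q * z) - site (\<mu> i) \<noteq> 0"
    if "\<mu> \<in> configs N m" "i \<in> {1..N}" "z \<in> S - ?E" for \<mu> i and z :: complex
  proof -
    have "\<mu> i \<le> m" using that by (auto simp: configs_def PiE_iff)
    then show "sigma u z - site (\<mu> i) \<noteq> 0" "sigma u (q * z) - site (\<mu> i) \<noteq> 0"
      using that(3) by (auto simp: exceptional_pts_def)
  qed
  have "(\<lambda>z. 1 * nekrasov_R N q u m V \<Phi>p \<Phi>m z) holomorphic_on S - ?E"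
    unfolding mult_nekrasov_R by (intro holomorphic_intros \<sigma> \<Phi>') (rule nz, assumption+)+
  then show ?thesis by simp
qed

text \<open>A pole of one of the two products is, except at the four points where \<open>\<Phi>\<^sup>\<plusminus>\<close> vanish, also a
  pole of the other one, coming from a neighbouring lattice site.\<close>

lemma neighbour_cases:
  fixes z :: complex
  obtains a b where "a \<le> m" "b \<le> m" "a = Suc b \<or> b = Suc a"
      "sigma u z = site a" "sigma u (q * z) = site b"
  | "z = 1 \<or> z = of_real (u * q ^ m) \<or> (\<forall>x\<le>m. sigma u z \<noteq> site x)"
    "z = of_real (inverse (q ^ Suc m)) \<or> z = of_real (u / q) \<or> (\<forall>x\<le>m. sigma u (q * z) \<noteq> site x)"
proof (cases "\<exists>a b. a \<le> m \<and> b \<le> m \<and> (a = Suc b \<or> b = Suc a) \<and>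
    sigma u z = site a \<and> sigma u (q * z) = site b")
  case True
  then show ?thesis using that(1) by blast
next
  case False
  have q0: "of_real q \<noteq> (0 :: complex)" using q by simp
  \<comment> \<open>Passing from \<open>z\<close> to \<open>q * z\<close> lowers the site index by
    one on the branch \<open>inverse (q ^ x)\<close> and raises it by one on the branch
    \<open>u * q ^ x\<close>. The neighbour is missing only for \<open>x = 0\<close> on the first
    branch and \<open>x = m\<close> on the second.\<close>
  have 1: "z = 1 \<or> z = of_real (u * q ^ m)" if x: "x \<le> m" "sigma u z = site x" for x
    using x(2) unfolding sigma_eq_site_iff
  proof
    assume z: "z = of_real (inverse (q ^ x))"
    show ?thesis
    proof (cases x)
      case 0
      then show ?thesis using z by simp
    next
      case (Suc y)
      then have "of_real q * z = of_real (inverse (q ^ y))"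
        using z q0 by (simp add: field_simps)
      then have "sigma u (q * z) = site y" by (simp add: sigma_eq_site_iff)
      then show ?thesis using False x Suc by (metis Suc_leD)
    qed
  next
    assume z: "z = of_real (u * q ^ x)"
    show ?thesis
    proof (cases "x = m")
      case True
      then show ?thesis using z by simp
    next
      case neq: False
      have "of_real q * z = of_real (u * q ^ Suc x)"
        using z by (simp add: mult_ac)
      then have "sigma u (q * z) = site (Suc x)" by (simp add: sigma_eq_site_iff)
      moreover have "Suc x \<le> m" using neq x by simp
      ultimately show ?thesis using False x by blast
    qed
  qed
  \<comment> \<open>Dividing by \<open>q\<close> shifts the index the other way, so the missing
    neighbours are now at \<open>x = m\<close> on the first branch and \<open>x = 0\<close> on the
    second.\<close>
  have 2: "z = of_real (inverse (q ^ Suc m)) \<or> z = of_real (u / q)"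
    if x: "x \<le> m" "sigma u (q * z) = site x" for x
    using x(2) unfolding sigma_eq_site_iff
  proof
    assume "of_real q * z = of_real (inverse (q ^ x))"
    then have z: "z = of_real (inverse (q ^ Suc x))"
      using q0 by (simp add: field_simps)
    show ?thesis
    proof (cases "x = m")
      case True
      then show ?thesis using z by simp
    next
      case neq: False
      have "sigma u z = site (Suc x)" using z by (simp add: sigma_eq_site_iff)
      moreover have "Suc x \<le> m" using neq x by simp
      ultimately show ?thesis using False x by blast
    qed
  next
    assume qz: "of_real q * z = of_real (u * q ^ x)"
    show ?thesis
    proof (cases x)
      case 0
      then show ?thesis using qz q0 by (simp add: field_simps)
    next
      case (Suc y)
      then have "z = of_real (u * q ^ y)" using qz q0 by (simp add: field_simps)
      then have "sigma u z = site y" by (simp add: sigma_eq_site_iff)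
      then show ?thesis using False x Suc by (metis Suc_leD)
    qed
  qed
  show ?thesis using 1 2 that(2) by blast
qed

lemma nekrasov_R_removable:
  fixes z :: complex
  assumes "z \<noteq> 0" and cont: "isCont \<Phi>p z" "isCont \<Phi>m z"
    and ratio: "\<And>a b. \<lbrakk>a \<le> m; b \<le> m; sigma u z = site a; sigma u (q * z) = site b\<rbrakk> \<Longrightarrow>
      complex_of_real (weight N V (lattice_pt q u a) / weight N V (lattice_pt q u b)) =
        (q * (z ^ 2 - u) * \<Phi>p z) / ((q ^ 2 * z ^ 2 - u) * \<Phi>m z)"
    and zeros: "z = of_real (inverse (q ^ Suc m)) \<Longrightarrow> \<Phi>p z = 0" "z = 1 \<Longrightarrow> \<Phi>m z = 0"
      "z = of_real (u / q) \<Longrightarrow> \<Phi>p z = 0" "z = of_real (u * q ^ m) \<Longrightarrow> \<Phi>m z = 0"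
  shows "((\<lambda>w. (w - z) * nekrasov_R N q u m V \<Phi>p \<Phi>m w) \<longlongrightarrow> 0) (at z)"
proof (cases rule: neighbour_cases[of m z])
  case (1 a b)
  have w: "weight N V y \<noteq> 0" for y by (simp add: weight_def)
  note r = ratio[OF 1(1,2,4,5)]
  \<comment> \<open>the weights do not vanish, so neither does the denominator (\<open>x / 0 = 0\<close>)\<close>
  have "(q ^ 2 * z ^ 2 - u) * \<Phi>m z \<noteq> 0"
  proof
    assume "(q ^ 2 * z ^ 2 - u) * \<Phi>m z = 0"
    with r have "complex_of_real (weight N V (lattice_pt q u a) / weight N V (lattice_pt q u b)) = 0"
      by (simp only: div_by_0)
    then show False using w by simp
  qed
  then have "of_real (weight N V (lattice_pt q u a)) * ((q ^ 2 * z ^ 2 - u) * \<Phi>m z) =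
      of_real (weight N V (lattice_pt q u b)) * (q * (z ^ 2 - u) * \<Phi>p z)"
    using r w by (simp add: frac_eq_eq mult_ac)
  from residue_pair_cancel[OF 1 cont this] show ?thesis .
next
  case 2
  then show ?thesis
    using zeros by (intro residue_zero_or_regular assms) blast+
qed

section \<open>Behaviour at infinity and at 0\<close>

text \<open>Divided by \<open>z\<close>, numerator and denominator become polynomials in
  \<open>inverse z\<close> with constant terms \<open>q\<close> and 1, whatever \<open>c\<close>
  is.\<close>

lemma sigma_ratio_at_infinity:
  "((\<lambda>z :: complex. (sigma u (q * z) - c) / (sigma u z - c)) \<longlongrightarrow> of_real q) at_infinity"
proof -
  have inv: "(inverse \<longlongrightarrow> (0 :: complex)) at_infinity" by (rule tendsto_inverse_0)
  have "((\<lambda>z :: complex. (q + of_real (u / q) * inverse z ^ 2 - c * inverse z) /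
      (1 + u * inverse z ^ 2 - c * inverse z)) \<longlongrightarrow>
      (of_real q + of_real (u / q) * 0 ^ 2 - c * 0) / (1 + of_real u * 0 ^ 2 - c * 0)) at_infinity"
    using q by (intro tendsto_intros inv) auto
  moreover have "\<forall>\<^sub>F z :: complex in at_infinity. (q + of_real (u / q) * inverse z ^ 2 - c * inverse z) /
      (1 + u * inverse z ^ 2 - c * inverse z) = (sigma u (q * z) - c) / (sigma u z - c)"
    using eventually_not_equal_at_infinity[of 0]
  proof eventually_elim
    case (elim z)
    have "(q + of_real (u / q) * inverse z ^ 2 - c * inverse z) * z = sigma u (q * z) - c"
      "(1 + u * inverse z ^ 2 - c * inverse z) * z = sigma u z - c"
      using elim q by (simp_all add: sigma_def field_simps power2_eq_square)
    then show ?case using elim by (metis mult_divide_mult_cancel_right)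
  qed
  ultimately show ?thesis by (simp add: Lim_transform_eventually)
qed

text \<open>Multiplied by \<open>z\<close>, numerator and denominator become polynomials in
  \<open>z\<close> with values \<open>u / q\<close> and \<open>u\<close> at 0; here \<open>u\<close>
  has to be nonzero.\<close>

lemma sigma_ratio_at_0:
  "((\<lambda>z :: complex. (sigma u (q * z) - c) / (sigma u z - c)) \<longlongrightarrow> inverse (of_real q)) (at 0)"
proof -
  have "((\<lambda>z :: complex. (q * z ^ 2 + of_real (u / q) - c * z) / (z ^ 2 + u - c * z)) \<longlongrightarrow>
      (of_real q * 0 ^ 2 + of_real (u / q) - c * 0) / (0 ^ 2 + of_real u - c * 0)) (at 0)"
    using q u by (intro tendsto_intros) auto
  moreover have "\<forall>\<^sub>F z :: complex in at 0. (q * z ^ 2 + of_real (u / q) - c * z) / (z ^ 2 + u - c * z) =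
      (sigma u (q * z) - c) / (sigma u z - c)"
    using eventually_neq_at_within[of 0]
  proof eventually_elim
    case (elim z)
    have "q * z ^ 2 + of_real (u / q) - c * z = (sigma u (q * z) - c) * z"
      "z ^ 2 + u - c * z = (sigma u z - c) * z"
      using elim q by (simp_all add: sigma_def field_simps power2_eq_square)
    then show ?case using elim by simp
  qed
  ultimately show ?thesis
    using u by (simp add: Lim_transform_eventually inverse_eq_divide)
qed

text \<open>The limit of a factor does not depend on the lattice point, so every configuration gives
  the same power; the reversed quotient follows by inversion.\<close>

lemma tendsto_quot:
  assumes lim: "\<And>c. ((\<lambda>z. (s z - c) / (t z - c)) \<longlongrightarrow> l) F" and "l \<noteq> 0"
  shows "((\<lambda>z. quot N \<mu> (s z) (t z)) \<longlongrightarrow> l ^ N) F"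
    and "((\<lambda>z. quot N \<mu> (t z) (s z)) \<longlongrightarrow> inverse l ^ N) F"
proof -
  have "((\<lambda>z. quot N \<mu> (s z) (t z)) \<longlongrightarrow> (\<Prod>i = 1..N. l)) F"
    by (intro tendsto_intros lim)
  then show "((\<lambda>z. quot N \<mu> (s z) (t z)) \<longlongrightarrow> l ^ N) F" by simp
  have "((\<lambda>z. (t z - c) / (s z - c)) \<longlongrightarrow> inverse l) F" for c
    using tendsto_inverse[OF lim \<open>l \<noteq> 0\<close>] by (simp add: inverse_divide)
  then have "((\<lambda>z. quot N \<mu> (t z) (s z)) \<longlongrightarrow> (\<Prod>i = 1..N. inverse l)) F"
    by (intro tendsto_intros)
  then show "((\<lambda>z. quot N \<mu> (t z) (s z)) \<longlongrightarrow> inverse l ^ N) F" by simp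
qed

lemma nekrasov_R_removable_0:
  assumes "isCont \<Phi>p 0" "isCont \<Phi>m 0"
  shows "((\<lambda>w. (w - 0) * nekrasov_R N q u m V \<Phi>p \<Phi>m w) \<longlongrightarrow> 0) (at 0)"
proof -
  note cont = assms[unfolded isCont_def]
  have "inverse (of_real q) \<noteq> (0 :: complex)" using q by simp
  note lim = tendsto_quot[OF sigma_ratio_at_0 this]
  have "((\<lambda>w. (w - 0) * nekrasov_R N q u m V \<Phi>p \<Phi>m w) \<longlongrightarrow>
      (\<Sum>\<mu>\<in>configs N m. of_real (gas_weight N q u V \<mu> / (\<Sum>\<nu>\<in>configs N m. gas_weight N q u V \<nu>)) *
      (\<Phi>m 0 * ((0 - 0) * inverse (of_real q) ^ N) +
       \<Phi>p 0 * ((0 - 0) * inverse (inverse (of_real q)) ^ N)))) (at 0)"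
    unfolding mult_nekrasov_R by (intro tendsto_intros cont lim)
  then show ?thesis by simp
qed

lemma nekrasov_R_bigo:
  assumes "\<Phi>p \<in> O[at_infinity](\<lambda>z. z ^ d)" "\<Phi>m \<in> O[at_infinity](\<lambda>z. z ^ d)"
  shows "nekrasov_R N q u m V \<Phi>p \<Phi>m \<in> O[at_infinity](\<lambda>z. z ^ d)"
proof -
  have "of_real q \<noteq> (0 :: complex)" using q by simp
  note lim = tendsto_quot[OF sigma_ratio_at_infinity this]
  have bounded: "f \<in> O[at_infinity](\<lambda>z. 1)" if "(f \<longlongrightarrow> c) at_infinity"
    for f :: "complex \<Rightarrow> complex" and c
    by (rule bigoI_tendsto[of _ _ c]) (use that in auto)
  have cmult: "(\<lambda>z. c * f z) \<in> O[at_infinity](\<lambda>z. z ^ d)" if "f \<in> O[at_infinity](\<lambda>z. z ^ d)"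
    for f :: "complex \<Rightarrow> complex" and c
    using landau_o.big.mult[OF bounded[OF tendsto_const] that] by simp
  note mult = landau_o.big.mult[OF assms(2) bounded[OF lim(1)]]
    landau_o.big.mult[OF assms(1) bounded[OF lim(2)]]
  have "(\<lambda>z. 1 * nekrasov_R N q u m V \<Phi>p \<Phi>m z) \<in> O[at_infinity](\<lambda>z. z ^ d)"
    unfolding mult_nekrasov_R mult_1
    by (intro big_sum_in_bigo cmult sum_in_bigo) (use mult[unfolded mult_1_right] in blast)+
  then show ?thesis by simp
qed

section \<open>Location of the exceptional points\<close>

text \<open>The preimages of lattice points, together with their quotients by \<open>q\<close>, are
  the points \<open>inverse (q ^ y)\<close> and \<open>u * q ^ y / q\<close> with
  \<open>y \<le> Suc m\<close>. In the theorem it follows that \<open>D\<close> contains every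
  exceptional point.\<close>

lemma exceptional_pts_subset:
  "exceptional_pts q u m \<subseteq> complex_of_real ` ({q .. q powi (- int m - 1)} \<union> {u * q ^ (m + 1) .. u / q})"
proof
  fix z assume "z \<in> exceptional_pts q u m"
  then obtain x where x: "x \<le> m" "sigma u z = site x \<or> sigma u (q * z) = site x"
    by (auto simp: exceptional_pts_def)
  have pm: "q powi (- int m - 1) = inverse (q ^ Suc m)"
    using q by (simp add: power_int_diff power_int_minus divide_inverse mult.commute)
  have inv: "inverse (q ^ y) \<in> {q .. q powi (- int m - 1)}" if "y \<le> Suc m" for y
  proof -
    have "q ^ y \<le> 1" "q ^ Suc m \<le> q ^ y" "0 < q ^ y" "0 < q ^ Suc m"
      using q that by (auto intro: power_le_one power_decreasing simp del: power_Suc)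
    then have "1 \<le> inverse (q ^ y)" "inverse (q ^ y) \<le> inverse (q ^ Suc m)"
      by (auto simp: one_le_inverse simp del: power_Suc)
    then show ?thesis using q unfolding pm by simp
  qed
  have prd: "u * q ^ y / q \<in> {u * q ^ (m + 1) .. u / q}" if "y \<le> Suc m" for y
  proof -
    have "q ^ y \<le> 1" "q ^ Suc m \<le> q ^ y" "0 < q ^ y"
      using q that by (auto intro: power_le_one power_decreasing simp del: power_Suc)
    moreover have "q ^ y \<le> q ^ y / q"
      using q by (simp add: field_simps)
    ultimately have "q ^ (m + 1) \<le> q ^ y / q" "q ^ y / q \<le> 1 / q"
      using q by (auto intro: divide_right_mono)
    then have "u * q ^ (m + 1) \<le> u * (q ^ y / q)" "u * (q ^ y / q) \<le> u * (1 / q)"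
      using u by (intro mult_left_mono; simp)+
    then show ?thesis by simp
  qed
  have q0: "of_real q \<noteq> (0 :: complex)" using q by simp
  from x(2) consider "z = of_real (inverse (q ^ x))" | "z = of_real (u * q ^ x)"
    | "of_real q * z = of_real (inverse (q ^ x))" | "of_real q * z = of_real (u * q ^ x)"
    unfolding sigma_eq_site_iff by blast
  then show "z \<in> complex_of_real ` ({q .. q powi (- int m - 1)} \<union> {u * q ^ (m + 1) .. u / q})"
  proof cases
    case 1
    show ?thesis unfolding 1 by (intro imageI UnI1 inv) (use x in simp)
  next
    case 2
    then have z: "z = of_real (u * q ^ Suc x / q)" using q by simp
    show ?thesis unfolding z by (intro imageI UnI2 prd) (use x in simp)
  next
    case 3
    then have z: "z = of_real (inverse (q ^ Suc x))" using q0 by (simp add: field_simps)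
    show ?thesis unfolding z by (intro imageI UnI1 inv) (use x in simp)
  next
    case 4
    then have z: "z = of_real (u * q ^ x / q)" using q0 by (simp add: field_simps)
    show ?thesis unfolding z by (intro imageI UnI2 prd) (use x in simp)
  qed
qed

lemma lattice_pt_in_support_interval:
  assumes "x \<le> m"
  shows "lattice_pt q u x \<in> support_interval q u m"
proof -
  have mono: "lattice_pt q u x \<le> lattice_pt q u y" if "x \<le> y" for x y
    using lattice_pt_less[OF q u0 u(2), of x y] that by (cases "x = y") auto
  show ?thesis
    using mono[of 0 x] mono[OF assms] by (simp add: support_interval_def lattice_pt_def)
qed

end

section \<open>Extension over \<open>D\<close> and the polynomial case\<close>

theorem theorem1p2p3:
  fixes qlim mlim ulim A1 :: real
    and q u :: "nat \<Rightarrow> real" and m :: "nat \<Rightarrow> nat" and V :: "nat \<Rightarrow> real \<Rightarrow> real"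
    and D :: "complex set" and \<Phi>p \<Phi>m :: "complex \<Rightarrow> complex" and N :: nat
  assumes limits: "0 < qlim" "qlim < 1" "1 \<le> mlim" "0 \<le> ulim" "ulim < 1" "0 < A1"
    and q: "\<And>n. n \<ge> 1 \<Longrightarrow> 0 < q n \<and> q n < 1"
    and u: "\<And>n. n \<ge> 1 \<Longrightarrow> 0 \<le> u n \<and> u n < 1"
    and m: "\<And>n. n \<ge> 1 \<Longrightarrow> real (m n) \<ge> real n - 1"
    and close: "\<And>n. n \<ge> 1 \<Longrightarrow>
        Max {real n ^ 2 * \<bar>q n - qlim powr (1 / real n)\<bar>,
             \<bar>real (m n) - real n * mlim\<bar>,
             real n * \<bar>u n - ulim\<bar>} \<le> A1"
    and N: "N \<ge> 1"
    and V: "continuous_on (support_interval (q N) (u N) (m N)) (V N)"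
    and D: "open D" "D \<subseteq> - {0, complex_of_real (sqrt ulim), - complex_of_real (sqrt ulim)}"
    and D_contains: "complex_of_real ` ({q N .. q N powi (- int (m N) - 1)} \<union>
        {u N * q N ^ (m N + 1) .. u N / q N}) \<subseteq> D"
    and analytic: "\<Phi>p analytic_on D" "\<Phi>m analytic_on D"
    and ratio: "\<And>(z :: complex) s t. \<lbrakk>z \<in> D;
          s \<in> support_interval (q N) (u N) (m N); sigma (u N) z = complex_of_real s;
          t \<in> support_interval (q N) (u N) (m N); sigma (u N) (q N * z) = complex_of_real t\<rbrakk> \<Longrightarrow>
        complex_of_real (weight N (V N) s / weight N (V N) t) =
        (q N * (z ^ 2 - u N) * \<Phi>p z) / ((q N ^ 2 * z ^ 2 - u N) * \<Phi>m z)"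
    and zeros: "\<Phi>p (q N powi (- int (m N) - 1)) = 0" "\<Phi>m 1 = 0"
        "\<Phi>p (u N / q N) = 0" "\<Phi>m (u N * q N ^ m N) = 0"
  shows "(\<exists>F. F analytic_on D \<and>
           (\<forall>z \<in> D - exceptional_pts (q N) (u N) (m N).
              F z = nekrasov_R N (q N) (u N) (m N) (V N) \<Phi>p \<Phi>m z)) \<and>
         (\<forall>d. (\<exists>p. degree p \<le> d \<and> (\<forall>z \<in> D. \<Phi>p z = poly p z)) \<and>
              (\<exists>p. degree p \<le> d \<and> (\<forall>z \<in> D. \<Phi>m z = poly p z)) \<longrightarrow>
           (\<exists>r. degree r \<le> d \<and>
              (\<forall>z \<in> D - exceptional_pts (q N) (u N) (m N).
                 nekrasov_R N (q N) (u N) (m N) (V N) \<Phi>p \<Phi>m z = poly r z)))"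
proof -
  define qN uN mN VN where "qN = q N" and "uN = u N" and "mN = m N" and "VN = V N"
  note defs = qN_def[symmetric] uN_def[symmetric] mN_def[symmetric] VN_def[symmetric]
  let ?E = "exceptional_pts qN uN mN"
  let ?R = "nekrasov_R N qN uN mN VN"
  have qN: "0 < qN" "qN < 1" and uN: "0 \<le> uN" "uN < 1"
    using q[OF N] u[OF N] by (auto simp: defs)
  \<comment> \<open>For \<open>uN = 0\<close> the second interval in \<open>D_contains\<close> would
    be the single point 0, which \<open>D\<close> avoids.\<close>
  have "uN \<noteq> 0"
    using D_contains D(2) by (auto simp: defs)
  interpret q_lattice qN uN
    using qN uN \<open>uN \<noteq> 0\<close> by unfold_locales auto
  have E: "finite ?E" "?E \<subseteq> D"
    using finite_exceptional_pts[OF qN(1)] exceptional_pts_subset[of mN] D_contains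
    unfolding defs by auto
  have D0: "0 \<notin> D"
    using D(2) by auto
  have "qN powi (- int mN - 1) = inverse (qN ^ Suc mN)"
    using qN by (simp add: power_int_diff power_int_minus divide_inverse mult.commute)
  note zeros' = zeros[unfolded defs this]
  \<comment> \<open>Only the values of \<open>f\<close> and \<open>g\<close> at \<open>z\<close> and
    their continuity there enter, so this covers \<open>\<Phi>p\<close> and \<open>\<Phi>m\<close>
    themselves and later the polynomials that agree with them on \<open>D\<close>.\<close>
  have removable: "((\<lambda>w. (w - z) * ?R f g w) \<longlongrightarrow> 0) (at z)"
    if z: "z \<in> D" and fg: "f z = \<Phi>p z" "g z = \<Phi>m z" and cont: "isCont f z" "isCont g z" for f g z
  proof (rule nekrasov_R_removable[OF _ cont])
    show "z \<noteq> 0" using z D0 by auto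
    show "complex_of_real (weight N VN (lattice_pt qN uN a) / weight N VN (lattice_pt qN uN b)) =
        (qN * (z ^ 2 - uN) * f z) / ((qN ^ 2 * z ^ 2 - uN) * g z)"
      if "a \<le> mN" "b \<le> mN" "sigma uN z = site a" "sigma uN (qN * z) = site b" for a b
      using ratio[unfolded defs, OF z] lattice_pt_in_support_interval that fg by simp
  qed (use zeros' fg in auto)
  have "\<exists>F. F analytic_on D \<and> (\<forall>z\<in>D - ?E. F z = ?R \<Phi>p \<Phi>m z)"
    unfolding analytic_on_open[OF D(1)]
  proof (rule holomorphic_on_extend_finite[OF E(1) D(1)])
    show "?R \<Phi>p \<Phi>m holomorphic_on D - ?E"
      using analytic D0 by (intro holomorphic_nekrasov_R analytic_imp_holomorphic)
    show "((\<lambda>w. (w - z) * ?R \<Phi>p \<Phi>m w) \<longlongrightarrow> 0) (at z)" if "z \<in> ?E \<inter> D" for z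
      using that analytic
      by (intro removable) (auto intro!: analytic_at_imp_isCont elim: analytic_on_subset)
  qed
  moreover have "\<exists>r. degree r \<le> d \<and> (\<forall>z\<in>D - ?E. ?R \<Phi>p \<Phi>m z = poly r z)"
    if p: "degree p \<le> d" "\<forall>z\<in>D. \<Phi>p z = poly p z" and r: "degree r \<le> d" "\<forall>z\<in>D. \<Phi>m z = poly r z"
    for d p r
  proof -
    \<comment> \<open>With the polynomials in place of \<open>\<Phi>p\<close> and
      \<open>\<Phi>m\<close> the formula makes sense outside \<open>D\<close> too. Its possible
      singularities are 0 and the exceptional points; the latter lie in \<open>D\<close>, where the
      ratio condition is available.\<close>
    let ?P = "?R (poly p) (poly r)"
    have "\<exists>F. F holomorphic_on UNIV \<and> (\<forall>z\<in>UNIV - insert 0 ?E. F z = ?P z)"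
    proof (rule holomorphic_on_extend_finite)
      have "?P holomorphic_on - {0} - ?E"
        by (intro holomorphic_nekrasov_R holomorphic_intros) auto
      then show "?P holomorphic_on UNIV - insert 0 ?E"
        by (simp add: Compl_eq_Diff_UNIV Diff_insert2[symmetric])
      show "((\<lambda>w. (w - z) * ?P w) \<longlongrightarrow> 0) (at z)" if "z \<in> insert 0 ?E \<inter> UNIV" for z
      proof (cases "z = 0")
        case True
        then show ?thesis using nekrasov_R_removable_0[of "poly p" "poly r"] by simp
      next
        case False
        then show ?thesis using that E(2) p r by (intro removable) auto
      qed
    qed (use E in auto)
    then obtain F where F: "F holomorphic_on UNIV" "\<And>z. z \<notin> insert 0 ?E \<Longrightarrow> F z = ?P z"
      by blast
    have "bounded (insert 0 ?E)"
      using E(1) by (simp add: finite_imp_bounded)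
    then obtain B where B: "\<And>z. z \<in> insert 0 ?E \<Longrightarrow> norm z \<le> B"
      unfolding bounded_iff by blast
    \<comment> \<open>Beyond all exceptional points \<open>?P\<close> and its entire extension
      \<open>F\<close> coincide, so the growth bound passes to \<open>F\<close>.\<close>
    have "\<forall>\<^sub>F z in at_infinity. ?P z = F z"
      unfolding eventually_at_infinity
    proof (intro exI allI impI)
      fix z :: complex assume "B + 1 \<le> norm z"
      then have "z \<notin> insert 0 ?E" using B[of z] by linarith
      then show "?P z = F z" using F(2) by simp
    qed
    from landau_o.big.in_cong[OF this] have "F \<in> O[at_infinity](\<lambda>z. z ^ d)"
      using nekrasov_R_bigo[OF poly_bigo_at_infinity[OF p(1)] poly_bigo_at_infinity[OF r(1)]]
      by blast
    then obtain s where s: "degree s \<le> d" "\<forall>z. F z = poly s z"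
      using entire_bigo_power_imp_poly[OF F(1)] by blast
    have "?R \<Phi>p \<Phi>m z = poly s z" if "z \<in> D - ?E" for z
    proof -
      have "?R \<Phi>p \<Phi>m z = ?P z"
        using that p(2) r(2) by (simp add: nekrasov_R_def)
      also have "\<dots> = F z" by (intro F(2)[symmetric]) (use that D0 in auto)
      finally show ?thesis using s(2) by simp
    qed
    then show ?thesis using s(1) by blast
  qed
  ultimately show ?thesis
    unfolding defs by blast
qed

end
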